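(* Let $X_1$ and $X_2$ be compact metric spaces, and for $j=1,2$ let $\|\cdot\|_j$ be any norm on $\operatorname{Lip}(X_j)$ (not assumed to be complete). Suppose that $\operatorname{Iso}((\operatorname{Lip}(X_1),\|\cdot\|_1), (\operatorname{Lip}(X_2),\|\cdot\|_{2}))$ is equal to the set of all maps $S:\operatorname{Lip}(X_1)\to\operatorname{Lip}(X_2)$ for which there exist $\beta \in \operatorname{Lip}(X_2)$, $\alpha \in \mathbb{T}$, a surjective isometry $\pi: X_2 \to X_1$, and $\epsilon\in\{1,-1\}$ such that $S(f)=\beta + \alpha [f\circ \pi]^\epsilon$ for every $f \in \operatorname{Lip}(X_1)$. Suppose that a map $T:\operatorname{Lip}(X_1)\to\operatorname{Lip}(X_2)$ is 2-local in $\operatorname{Iso}((\operatorname{Lip}(X_1),\|\cdot\|_1), (\operatorname{Lip}(X_2),\|\cdot\|_{2}))$. Then $T \in \operatorname{Iso}((\operatorname{Lip}(X_1),\|\cdot\|_1), (\operatorname{Lip}(X_2),\|\cdot\|_{2}))$.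
   Context: For a compact metric space $(X,d)$, $\operatorname{Lip}(X)$ is the algebra of all complex-valued continuous functions $f$ on $X$ with $L(f)=\sup_{x\neq y}\frac{|f(x)-f(y)|}{d(x,y)}<\infty$. $\mathbb{T}=\{z\in\mathbb{C}:|z|=1\}$. For a complex-valued function $f$, $[f]^{1}=f$ and $[f]^{-1}=\overline{f}$ (complex conjugate). For normed spaces $\mathfrak{M}_1,\mathfrak{M}_2$, $\operatorname{Iso}(\mathfrak{M}_1,\mathfrak{M}_2)$ is the set of all surjective isometries (distance preserving maps, not necessarily linear) from $\mathfrak{M}_1$ onto $\mathfrak{M}_2$. A map $T:\mathfrak{M}_1\to\mathfrak{M}_2$ (no linearity, continuity or surjectivity assumed) is 2-local in $\operatorname{Iso}(\mathfrak{M}_1,\mathfrak{M}_2)$ if for every $x,y\in\mathfrak{M}_1$ there is $T_{x,y}\in\operatorname{Iso}(\mathfrak{M}_1,\mathfrak{M}_2)$ such that $T(x)=T_{x,y}(x)$ and $T(y)=T_{x,y}(y)$. *)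

theory Defs
  imports "HOL-Analysis.Analysis"
begin

text \<open>
  A metric space is a subset \<open>X\<close> of a type of class \<open>metric_space\<close> with the distance of that type,
  and functions on \<open>X\<close> are represented by total functions that vanish outside \<open>X\<close>. Such a
  total function is determined by its values on \<open>X\<close>, and the representation is compatible with the
  pointwise vector space operations.
\<close>

definition lip_const :: "'a::metric_space set \<Rightarrow> ('a \<Rightarrow> complex) \<Rightarrow> ennreal" where
  "lip_const X f =
     (SUP (x, y) \<in> {(x, y). x \<in> X \<and> y \<in> X \<and> x \<noteq> y}. ennreal (cmod (f x - f y) / dist x y))"

definition Lip :: "'a::metric_space set \<Rightarrow> ('a \<Rightarrow> complex) set" where
  "Lip X = {f. continuous_on X f \<and> lip_const X f < \<infinity> \<and> (\<forall>x. x \<notin> X \<longrightarrow> f x = 0)}"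

definition norm_on :: "('a \<Rightarrow> complex) set \<Rightarrow> (('a \<Rightarrow> complex) \<Rightarrow> real) \<Rightarrow> bool" where
  "norm_on V N \<longleftrightarrow>
     (\<forall>f\<in>V. 0 \<le> N f) \<and>
     (\<forall>f\<in>V. N f = 0 \<longleftrightarrow> f = (\<lambda>x. 0)) \<and>
     (\<forall>f\<in>V. \<forall>c::complex. N (\<lambda>x. c * f x) = cmod c * N f) \<and>
     (\<forall>f\<in>V. \<forall>g\<in>V. N (\<lambda>x. f x + g x) \<le> N f + N g)"

text \<open>
  A map between function spaces \<open>V\<close> and \<open>W\<close> is a total function of which only the values on \<open>V\<close>
  matter. Membership in the sets of maps below does not depend on the values outside \<open>V\<close>.
\<close>

definition Iso ::
  "('a \<Rightarrow> complex) set \<Rightarrow> (('a \<Rightarrow> complex) \<Rightarrow> real) \<Rightarrow>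
   ('b \<Rightarrow> complex) set \<Rightarrow> (('b \<Rightarrow> complex) \<Rightarrow> real) \<Rightarrow>
   (('a \<Rightarrow> complex) \<Rightarrow> ('b \<Rightarrow> complex)) set" where
  "Iso V N W M =
     {S. S ` V = W \<and>
         (\<forall>f\<in>V. \<forall>g\<in>V. M (\<lambda>y. S f y - S g y) = N (\<lambda>x. f x - g x))}"

definition two_local_in_Iso ::
  "('a \<Rightarrow> complex) set \<Rightarrow> (('a \<Rightarrow> complex) \<Rightarrow> real) \<Rightarrow>
   ('b \<Rightarrow> complex) set \<Rightarrow> (('b \<Rightarrow> complex) \<Rightarrow> real) \<Rightarrow>
   (('a \<Rightarrow> complex) \<Rightarrow> ('b \<Rightarrow> complex)) \<Rightarrow> bool" where
  "two_local_in_Iso V N W M T \<longleftrightarrow>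
     T \<in> V \<rightarrow> W \<and>
     (\<forall>f\<in>V. \<forall>g\<in>V. \<exists>S\<in>Iso V N W M. T f = S f \<and> T g = S g)"

definition surj_isometry :: "'b::metric_space set \<Rightarrow> 'a::metric_space set \<Rightarrow> ('b \<Rightarrow> 'a) \<Rightarrow> bool" where
  "surj_isometry Y X \<pi> \<longleftrightarrow>
     \<pi> ` Y = X \<and> (\<forall>y\<in>Y. \<forall>z\<in>Y. dist (\<pi> y) (\<pi> z) = dist y z)"

text \<open>The notation \<open>[z]\<^sup>\<epsilon>\<close>, used only for \<open>\<epsilon> \<in> {1, -1}\<close>; it is not the power of \<open>z\<close>.\<close>

definition conj_exp :: "complex \<Rightarrow> int \<Rightarrow> complex" where
  "conj_exp z \<epsilon> = (if \<epsilon> = 1 then z else cnj z)"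

definition canonical_maps ::
  "'a::metric_space set \<Rightarrow> 'b::metric_space set \<Rightarrow>
   (('a \<Rightarrow> complex) \<Rightarrow> ('b \<Rightarrow> complex)) set" where
  "canonical_maps X Y =
     {S. S \<in> Lip X \<rightarrow> Lip Y \<and>
         (\<exists>\<beta>\<in>Lip Y. \<exists>\<alpha>\<in>sphere 0 1. \<exists>\<pi>. \<exists>\<epsilon>\<in>{1, -1}.
            surj_isometry Y X \<pi> \<and>
            (\<forall>f\<in>Lip X. \<forall>y\<in>Y. S f y = \<beta> y + \<alpha> * conj_exp (f (\<pi> y)) \<epsilon>))}"

end

theory Submission
  imports Defs
begin

text \<open>
  Distances are preserved because on each pair of functions the map agrees with some
  surjective isometry, so only surjectivity is at stake. Subtract \<open>T 0\<close> and identify \<open>X\<^sub>2\<close> with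
  \<open>X\<^sub>1\<close> by one of the available isometries. The resulting map sends the orbit
  \<open>{\<alpha> [f \<circ> \<rho>]\<^sup>\<epsilon>}\<close> of each \<open>f\<close> into itself and preserves the uniform distance. The orbit is
  uniformly compact, since \<open>f\<close> is Lipschitz and the isometries of \<open>X\<^sub>1\<close> form a compact group,
  and a distance preserving self-map of a compact metric space is surjective.
\<close>

section \<open>Distance-preserving self-maps of compact spaces\<close>

text \<open>
  Here \<open>E e x y\<close> stands for ``the distance of \<open>x\<close> and \<open>y\<close> is at most \<open>e\<close>''; this form avoids
  suprema over possibly empty sets when it is used for the uniform distance.
\<close>

lemma isometric_self_map_surj:
  fixes E :: "real \<Rightarrow> 'c \<Rightarrow> 'c \<Rightarrow> bool"
  assumes sym: "\<And>e x y. E e x y \<Longrightarrow> E e y x"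
    and mono: "\<And>d e x y. E d x y \<Longrightarrow> d \<le> e \<Longrightarrow> E e x y"
    and tri: "\<And>d e x y z. E d x y \<Longrightarrow> E e y z \<Longrightarrow> E (d + e) x z"
    and sep: "\<And>x y. x \<in> K \<Longrightarrow> y \<in> K \<Longrightarrow> (\<And>e. e > 0 \<Longrightarrow> E e x y) \<Longrightarrow> x = y"
    and cluster: "\<And>s :: nat \<Rightarrow> 'c. range s \<subseteq> K \<Longrightarrow> \<exists>a\<in>K. \<forall>e>0. \<forall>N. \<exists>n\<ge>N. E e (s n) a"
    and self: "h \<in> K \<rightarrow> K"
    and iso: "\<And>e x y. x \<in> K \<Longrightarrow> y \<in> K \<Longrightarrow> E e (h x) (h y) \<longleftrightarrow> E e x y"
  shows "h ` K = K"
proof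
  show "h ` K \<subseteq> K"
    using self by auto
  show "K \<subseteq> h ` K"
  proof
    fix x assume x: "x \<in> K"
    have it: "(h ^^ n) y \<in> K" if "y \<in> K" for n y
      using that self by (induction n) auto
    have iso_it: "E e ((h ^^ n) y) ((h ^^ n) z) \<longleftrightarrow> E e y z" if "y \<in> K" "z \<in> K" for e n y z
      using that by (induction n) (auto simp: iso it)
    \<comment> \<open>Recurrence: two iterates of \<open>x\<close> lie near the same cluster point,
      hence near each other, and cancelling the common \<open>h ^^ m\<close> leaves \<open>x\<close>
      near a later point of its own forward orbit.\<close>
    have recur: "\<exists>y\<in>K. E e x (h y)" if "e > 0" for e
    proof -
      have "range (\<lambda>n. (h ^^ n) x) \<subseteq> K"
        using it x by auto
      from cluster[OF this] obtain a where
        a: "\<And>d N. d > 0 \<Longrightarrow> \<exists>n\<ge>N. E d ((h ^^ n) x) a"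
        by blast
      obtain m where m: "E (e/2) ((h ^^ m) x) a"
        using a[of "e/2" 0] \<open>e > 0\<close> by auto
      obtain n where n: "n \<ge> Suc m" "E (e/2) ((h ^^ n) x) a"
        using a[of "e/2" "Suc m"] \<open>e > 0\<close> by auto
      \<comment> \<open>Since \<open>n\<close> was chosen strictly above \<open>m\<close>, one
        application of \<open>h\<close> survives the cancellation; this puts the nearby point in the
        image of \<open>h\<close>.\<close>
      define k where "k = n - Suc m"
      have "(h ^^ n) x = (h ^^ m) (h ((h ^^ k) x))"
      proof -
        have "n = m + Suc k" using n(1) by (simp add: k_def)
        then show ?thesis by (simp only: funpow_add) simp
      qed
      moreover have "E e ((h ^^ m) x) ((h ^^ n) x)"
        using tri[OF m sym[OF n(2)]] by simp
      ultimately have "E e x (h ((h ^^ k) x))"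
        using iso_it it[OF x] self x by (metis Pi_iff)
      then show ?thesis
        using it[OF x] by blast
    qed
    \<comment> \<open>Approximate preimages of \<open>x\<close> with errors tending to 0; a cluster
      point of them is an exact preimage, because \<open>h\<close> preserves distances and
      \<open>sep\<close> identifies points at distance 0.\<close>
    have "\<exists>y\<in>K. E (1 / real (Suc n)) x (h y)" for n
      by (rule recur) simp
    then obtain s where s: "\<And>n. s n \<in> K" "\<And>n. E (1 / real (Suc n)) x (h (s n))"
      by metis
    then obtain a where a: "a \<in> K" "\<And>d N. d > 0 \<Longrightarrow> \<exists>n\<ge>N. E d (s n) a"
      using cluster[of s] by blast
    have "E e x (h a)" if "e > 0" for e
    proof -
      obtain N where N: "1 / real (Suc N) < e/2"
        using \<open>e > 0\<close> nat_approx_posE[of "e/2"] by auto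
      obtain n where n: "n \<ge> N" "E (e/2) (s n) a"
        using a(2)[of "e/2" N] \<open>e > 0\<close> by auto
      have "1 / real (Suc n) \<le> 1 / real (Suc N)"
        using n(1) by (simp add: frac_le)
      then have "E (e/2) x (h (s n))"
        using N by (intro mono[OF s(2)]) linarith
      moreover have "E (e/2) (h (s n)) (h a)"
        using n(2) iso s(1) a(1) by blast
      ultimately show ?thesis
        using tri by fastforce
    qed
    then have "x = h a"
      using sep x a(1) self by auto
    then show "x \<in> h ` K"
      using a(1) by blast
  qed
qed


text \<open>Needed because a limit of surjective isometries is, to begin with, only known to
  preserve distances; compactness of \<open>X\<close> gives back its surjectivity.\<close>

lemma compact_isometric_self_map_surj:
  fixes X :: "'a::metric_space set"
  assumes "compact X" and self: "h \<in> X \<rightarrow> X"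
    and iso: "\<And>x y. x \<in> X \<Longrightarrow> y \<in> X \<Longrightarrow> dist (h x) (h y) = dist x y"
  shows "h ` X = X"
proof (rule isometric_self_map_surj[where E = "\<lambda>e x y. dist x y \<le> e"])
  fix s :: "nat \<Rightarrow> 'a" assume "range s \<subseteq> X"
  then obtain l r where l: "l \<in> X" "strict_mono r" "(s \<circ> r) \<longlonglongrightarrow> l"
    using \<open>compact X\<close> unfolding compact_def by blast
  have "\<exists>n\<ge>N. dist (s n) l \<le> e" if "e > 0" for e N
  proof -
    obtain M where "\<And>n. n \<ge> M \<Longrightarrow> dist ((s \<circ> r) n) l < e"
      using l(3) \<open>e > 0\<close> unfolding lim_sequentially by blast
    then have "dist (s (r (max M N))) l \<le> e"
      by (simp add: less_imp_le)
    moreover have "r (max M N) \<ge> N"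
      using seq_suble[OF l(2), of "max M N"] by linarith
    ultimately show ?thesis by blast
  qed
  with l(1) show "\<exists>a\<in>X. \<forall>e>0. \<forall>N. \<exists>n\<ge>N. dist (s n) a \<le> e"
    by blast
next
  fix d e :: real and x y z :: 'a
  assume "dist x y \<le> d" "dist y z \<le> e"
  then show "dist x z \<le> d + e"
    using dist_triangle[of x z y] by linarith
next
  fix x y :: 'a
  assume "\<And>e. e > 0 \<Longrightarrow> dist x y \<le> e"
  then have "dist x y \<le> 0"
    by (rule field_le_epsilon) auto
  then show "x = y" by simp
qed (use self iso in \<open>auto simp: dist_commute\<close>)

section \<open>Cluster points of sequences of isometries\<close>

text \<open>The image of the sequential filter under \<open>s\<close> is proper and lives on
  \<open>K\<close>, so it has a cluster point there. Neighbourhoods replace subsequences because the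
  application is to a possibly uncountable product, where compactness need not give convergent
  subsequences.\<close>

lemma compact_imp_frequently_nhd:
  fixes s :: "nat \<Rightarrow> 'c::topological_space"
  assumes "compact K" and "range s \<subseteq> K"
  shows "\<exists>a\<in>K. \<forall>U. open U \<longrightarrow> a \<in> U \<longrightarrow> (\<forall>N. \<exists>n\<ge>N. s n \<in> U)"
proof -
  have "filtermap s sequentially \<noteq> bot"
    by (simp add: filtermap_bot_iff)
  moreover have "eventually (\<lambda>x. x \<in> K) (filtermap s sequentially)"
    unfolding eventually_filtermap using assms(2) by (intro always_eventually) auto
  ultimately obtain a where a: "a \<in> K" "inf (nhds a) (filtermap s sequentially) \<noteq> bot"
    using \<open>compact K\<close> unfolding compact_filter by blast
  have "\<exists>n\<ge>N. s n \<in> U" if U: "open U" "a \<in> U" for U N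
  proof (rule ccontr)
    assume "\<not> (\<exists>n\<ge>N. s n \<in> U)"
    then have "eventually (\<lambda>x. x \<notin> U) (filtermap s sequentially)"
      by (auto simp: eventually_filtermap eventually_sequentially)
    moreover have "eventually (\<lambda>x. x \<in> U) (nhds a)"
      using U by (rule eventually_nhds_in_open)
    ultimately have "eventually (\<lambda>_. False) (inf (nhds a) (filtermap s sequentially))"
      unfolding eventually_inf by blast
    with a(2) show False
      by (simp add: trivial_limit_def)
  qed
  with a(1) show ?thesis by blast
qed

text \<open>Tychonoff's theorem, transferred to the type-class topology on functions.\<close>

lemma compact_fun_PiE:
  fixes S :: "'b \<Rightarrow> 'a::topological_space set"
  assumes "\<And>i. compact (S i)"
  shows "compact (PiE UNIV S)"
  using assms compactin_PiE[of "\<lambda>_. euclidean" UNIV S]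
  by (simp add: euclidean_product_topology)

text \<open>An Arzela-Ascoli argument: Tychonoff gives a pointwise cluster point, and equicontinuity
  of isometries makes the approximation uniform on the compact \<open>X\<close>. The sequence
  \<open>c\<close> is carried along so that the same indices \<open>n\<close> work for scalar
  parameters and isometries.\<close>

lemma isometries_cluster:
  fixes X :: "'b::metric_space set" and Y :: "'a::metric_space set"
    and \<rho> :: "nat \<Rightarrow> 'b \<Rightarrow> 'a" and c :: "nat \<Rightarrow> 'c::metric_space"
  assumes "compact X" and "compact Y" and "compact C"
    and c: "\<And>n. c n \<in> C"
    and maps: "\<And>n. \<rho> n ` X \<subseteq> Y"
    and iso: "\<And>n x y. x \<in> X \<Longrightarrow> y \<in> X \<Longrightarrow> dist (\<rho> n x) (\<rho> n y) = dist x y"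
  obtains a \<sigma> where "a \<in> C" "\<sigma> ` X \<subseteq> Y"
    "\<And>x y. x \<in> X \<Longrightarrow> y \<in> X \<Longrightarrow> dist (\<sigma> x) (\<sigma> y) = dist x y"
    "\<And>e N. e > 0 \<Longrightarrow> \<exists>n\<ge>N. dist (c n) a < e \<and> (\<forall>x\<in>X. dist (\<rho> n x) (\<sigma> x) < e)"
proof -
  \<comment> \<open>The product runs over the whole type; pinning the coordinates outside
    \<open>X\<close> to a single value makes every factor compact.\<close>
  define P where "P = PiE UNIV (\<lambda>x. if x \<in> X then Y else {undefined})"
  define s where "s n = (c n, \<lambda>x. if x \<in> X then \<rho> n x else undefined)" for n
  have "compact (C \<times> P)"
    unfolding P_def using assms by (intro compact_Times compact_fun_PiE) auto
  moreover have "range s \<subseteq> C \<times> P"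
    using c maps by (auto simp: s_def P_def PiE_iff image_subset_iff)
  ultimately obtain p where p: "p \<in> C \<times> P"
    and nhd: "\<And>U N. open U \<Longrightarrow> p \<in> U \<Longrightarrow> \<exists>n\<ge>N. s n \<in> U"
    using compact_imp_frequently_nhd[of "C \<times> P" s] by blast
  obtain a \<sigma> where p_eq: "p = (a, \<sigma>)" by fastforce
  have a: "a \<in> C" and \<sigma>: "\<sigma> ` X \<subseteq> Y"
    using p by (auto simp: p_eq P_def PiE_iff split: if_splits)
  \<comment> \<open>A basic open set of the product topology constrains finitely many coordinates,
    so closeness is first obtained on finite sets only.\<close>
  have near: "\<exists>n\<ge>N. dist (c n) a < e \<and> (\<forall>x\<in>F. dist (\<rho> n x) (\<sigma> x) < e)"
    if "e > 0" "finite F" "F \<subseteq> X" for e F N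
  proof -
    define V where "V = (\<Inter>x\<in>F. (\<lambda>r. r x) -` ball (\<sigma> x) e)"
    have "open V"
      unfolding V_def using \<open>finite F\<close>
      by (intro open_INT ballI open_vimage open_ball continuous_on_product_coordinates)
    then have "open (ball a e \<times> V)"
      by (intro open_Times open_ball)
    moreover have "p \<in> ball a e \<times> V"
      using \<open>e > 0\<close> by (auto simp: p_eq V_def)
    ultimately have "\<exists>n\<ge>N. s n \<in> ball a e \<times> V"
      by (rule nhd)
    then obtain n where "n \<ge> N" "s n \<in> ball a e \<times> V"
      by auto
    then have "dist (c n) a < e" and "\<And>x. x \<in> F \<Longrightarrow> dist (\<rho> n x) (\<sigma> x) < e"
      using \<open>F \<subseteq> X\<close> by (auto simp: s_def V_def dist_commute subset_iff split: if_splits)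
    with \<open>n \<ge> N\<close> show ?thesis
      by blast
  qed
  \<comment> \<open>Preservation of distances involves two points at a time, so the finite set
    \<open>{x, y}\<close> suffices.\<close>
  have \<sigma>_iso: "dist (\<sigma> x) (\<sigma> y) = dist x y" if "x \<in> X" "y \<in> X" for x y
  proof -
    have "\<bar>dist (\<sigma> x) (\<sigma> y) - dist x y\<bar> \<le> e" if "e > 0" for e
    proof -
      obtain n where "dist (\<rho> n x) (\<sigma> x) < e/2" "dist (\<rho> n y) (\<sigma> y) < e/2"
        using near[of "e/2" "{x, y}" 0] \<open>e > 0\<close> \<open>x \<in> X\<close> \<open>y \<in> X\<close> by auto
      moreover have "dist (\<rho> n x) (\<rho> n y) = dist x y"
        using iso \<open>x \<in> X\<close> \<open>y \<in> X\<close> by blast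
      moreover have "dist (\<sigma> x) (\<sigma> y) \<le> dist (\<rho> n x) (\<sigma> x) + dist (\<rho> n x) (\<rho> n y) + dist (\<rho> n y) (\<sigma> y)"
        using dist_triangle[of "\<sigma> x" "\<sigma> y" "\<rho> n x"] dist_triangle[of "\<rho> n x" "\<sigma> y" "\<rho> n y"]
        by (simp add: dist_commute)
      moreover have "dist (\<rho> n x) (\<rho> n y) \<le> dist (\<rho> n x) (\<sigma> x) + dist (\<sigma> x) (\<sigma> y) + dist (\<rho> n y) (\<sigma> y)"
        using dist_triangle[of "\<rho> n x" "\<rho> n y" "\<sigma> x"] dist_triangle[of "\<sigma> x" "\<rho> n y" "\<sigma> y"]
        by (simp add: dist_commute)
      ultimately show ?thesis by linarith
    qed
    then have "\<bar>dist (\<sigma> x) (\<sigma> y) - dist x y\<bar> \<le> 0"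
      by (rule field_le_epsilon) simp
    then show ?thesis by simp
  qed
  have "\<exists>n\<ge>N. dist (c n) a < e \<and> (\<forall>x\<in>X. dist (\<rho> n x) (\<sigma> x) < e)" if "e > 0" for e N
  proof -
    \<comment> \<open>A finite \<open>e/3\<close>-net. From \<open>x\<close> one passes to a net
      point \<open>y\<close>: moving under \<open>\<rho> n\<close>, changing \<open>\<rho> n\<close>
      to \<open>\<sigma>\<close> at \<open>y\<close>, and moving back under \<open>\<sigma>\<close>
      each cost less than \<open>e/3\<close>.\<close>
    obtain F where F: "finite F" "F \<subseteq> X" "X \<subseteq> (\<Union>x\<in>F. ball x (e/3))"
    proof (rule compactE_image[OF \<open>compact X\<close>, of X "\<lambda>x. ball x (e/3)"])
      show "X \<subseteq> (\<Union>x\<in>X. ball x (e/3))"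
        using \<open>e > 0\<close> by auto
    qed auto
    obtain n where n: "n \<ge> N" "dist (c n) a < e/3" "\<forall>y\<in>F. dist (\<rho> n y) (\<sigma> y) < e/3"
      using near[of "e/3" F N] F \<open>e > 0\<close> by auto
    have "dist (\<rho> n x) (\<sigma> x) < e" if x: "x \<in> X" for x
    proof -
      obtain y where y: "y \<in> F" "dist y x < e/3"
        using F(3) x by auto
      have "dist (\<rho> n x) (\<rho> n y) < e/3" "dist (\<sigma> x) (\<sigma> y) < e/3"
        using iso[of x y n] \<sigma>_iso[of x y] x y F(2) by (auto simp: dist_commute)
      moreover have "dist (\<rho> n y) (\<sigma> y) < e/3"
        using n(3) y(1) by blast
      ultimately show ?thesis
        using dist_triangle[of "\<rho> n x" "\<sigma> x" "\<rho> n y"] dist_triangle[of "\<rho> n y" "\<sigma> x" "\<sigma> y"]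
        by (simp add: dist_commute)
    qed
    with n \<open>e > 0\<close> show ?thesis by force
  qed
  with a \<sigma> \<sigma>_iso show thesis by (rule that)
qed

section \<open>Conjugation, surjective isometries and Lipschitz functions\<close>

lemma cmod_conj_exp [simp]: "cmod (conj_exp z \<epsilon>) = cmod z"
  by (simp add: conj_exp_def)

lemma conj_exp_diff: "conj_exp (z - w) \<epsilon> = conj_exp z \<epsilon> - conj_exp w \<epsilon>"
  by (simp add: conj_exp_def)

lemma conj_exp_mult: "conj_exp (z * w) \<epsilon> = conj_exp z \<epsilon> * conj_exp w \<epsilon>"
  by (simp add: conj_exp_def)

lemma conj_exp_conj_exp:
  "\<delta> \<in> {1, -1} \<Longrightarrow> \<epsilon> \<in> {1, -1} \<Longrightarrow> conj_exp (conj_exp z \<delta>) \<epsilon> = conj_exp z (\<delta> * \<epsilon>)"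
  by (auto simp: conj_exp_def)

lemma surj_isometry_compose:
  assumes "surj_isometry X Y \<rho>" and "surj_isometry Y Z \<pi>"
  shows "surj_isometry X Z (\<pi> \<circ> \<rho>)"
  using assms by (auto simp: surj_isometry_def image_comp[symmetric])

lemma surj_isometry_inverse:
  assumes "surj_isometry X Y \<pi>"
  obtains \<sigma> where "surj_isometry Y X \<sigma>" "\<And>x. x \<in> X \<Longrightarrow> \<sigma> (\<pi> x) = x"
proof
  have inj: "inj_on \<pi> X"
    using assms by (intro inj_onI) (metis dist_eq_0_iff surj_isometry_def)
  have Y: "Y = \<pi> ` X"
    using assms by (simp add: surj_isometry_def)
  show inv: "inv_into X \<pi> (\<pi> x) = x" if "x \<in> X" for x
    using inj that by simp
  show "surj_isometry Y X (inv_into X \<pi>)"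
    using assms inj by (auto simp: surj_isometry_def Y image_comp)
qed

text \<open>Trades the extended supremum for a real Lipschitz constant, which in turn forces
  continuity.\<close>

lemma Lip_iff:
  "f \<in> Lip X \<longleftrightarrow>
     (\<exists>L\<ge>0. \<forall>x\<in>X. \<forall>y\<in>X. cmod (f x - f y) \<le> L * dist x y) \<and> (\<forall>x. x \<notin> X \<longrightarrow> f x = 0)"
    (is "_ \<longleftrightarrow> ?lip \<and> ?supp")
proof (intro iffI conjI)
  assume f: "f \<in> Lip X"
  then obtain L where L: "lip_const X f = ennreal L" "0 \<le> L"
    by (cases "lip_const X f") (auto simp: Lip_def)
  have "cmod (f x - f y) \<le> L * dist x y" if "x \<in> X" "y \<in> X" for x y
  proof (cases "x = y")
    case False
    then have "ennreal (cmod (f x - f y) / dist x y) \<le> lip_const X f"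
      unfolding lip_const_def using that by (intro SUP_upper2[of "(x, y)"]) auto
    then show ?thesis
      using False L by (simp add: divide_le_eq)
  qed simp
  with L(2) show ?lip by blast
  show ?supp
    using f by (simp add: Lip_def)
next
  assume "?lip \<and> ?supp"
  then obtain L where L: "L \<ge> 0" "\<And>x y. x \<in> X \<Longrightarrow> y \<in> X \<Longrightarrow> cmod (f x - f y) \<le> L * dist x y"
    and supp: ?supp
    by blast
  have "L-lipschitz_on X f"
    using L by (intro lipschitz_onI) (auto simp: dist_norm)
  then have "continuous_on X f"
    by (rule lipschitz_on_continuous_on)
  moreover have "lip_const X f \<le> ennreal L"
    unfolding lip_const_def
    using L by (intro SUP_least) (auto intro!: ennreal_leI simp: divide_le_eq)
  then have "lip_const X f < \<infinity>"
    by (rule le_less_trans) simp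
  ultimately show "f \<in> Lip X"
    using supp by (simp add: Lip_def)
qed

lemma LipI:
  assumes "0 \<le> L" "\<And>x y. x \<in> X \<Longrightarrow> y \<in> X \<Longrightarrow> cmod (f x - f y) \<le> L * dist x y"
    "\<And>x. x \<notin> X \<Longrightarrow> f x = 0"
  shows "f \<in> Lip X"
  using assms by (auto simp: Lip_iff)

lemma LipE:
  assumes "f \<in> Lip X"
  obtains L where "0 \<le> L" "\<And>x y. x \<in> X \<Longrightarrow> y \<in> X \<Longrightarrow> cmod (f x - f y) \<le> L * dist x y"
  using assms by (auto simp: Lip_iff)

lemma Lip_eqI:
  assumes "f \<in> Lip X" "g \<in> Lip X" "\<And>x. x \<in> X \<Longrightarrow> f x = g x"
  shows "f = g"
  using assms by (metis Lip_iff ext)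

lemma zero_in_Lip: "(\<lambda>_. 0) \<in> Lip X"
  by (rule LipI[of 0]) auto

lemma Lip_diff:
  assumes "f \<in> Lip X" "g \<in> Lip X"
  shows "(\<lambda>x. f x - g x) \<in> Lip X"
proof -
  obtain L M where L: "0 \<le> L" "\<And>x y. x \<in> X \<Longrightarrow> y \<in> X \<Longrightarrow> cmod (f x - f y) \<le> L * dist x y"
    and M: "0 \<le> M" "\<And>x y. x \<in> X \<Longrightarrow> y \<in> X \<Longrightarrow> cmod (g x - g y) \<le> M * dist x y"
    using assms by (metis LipE)
  show ?thesis
  proof (rule LipI)
    fix x y assume xy: "x \<in> X" "y \<in> X"
    have "cmod (f x - g x - (f y - g y)) \<le> cmod (f x - f y) + cmod (g x - g y)"
      using norm_triangle_ineq4[of "f x - f y" "g x - g y"] by (simp add: algebra_simps)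
    also have "\<dots> \<le> (L + M) * dist x y"
      using L(2)[OF xy] M(2)[OF xy] by (simp add: algebra_simps)
    finally show "cmod (f x - g x - (f y - g y)) \<le> (L + M) * dist x y" .
  qed (use L M assms in \<open>auto simp: Lip_iff\<close>)
qed

section \<open>Twists of a function and compactness of their orbits\<close>

text \<open>A canonical map without its translation \<open>\<beta>\<close>, extended by 0 to match
  the representation of \<open>Lip\<close>. Distinct source and target types let it serve both as
  the action on \<open>Lip X1\<close> and as transport between the two spaces.\<close>

definition twist ::
  "'b::metric_space set \<Rightarrow> complex \<Rightarrow> int \<Rightarrow> ('b \<Rightarrow> 'a) \<Rightarrow> ('a \<Rightarrow> complex) \<Rightarrow> 'b \<Rightarrow> complex" where
  "twist X \<alpha> \<epsilon> \<rho> f = (\<lambda>x. if x \<in> X then \<alpha> * conj_exp (f (\<rho> x)) \<epsilon> else 0)"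

definition twist_orbit :: "'a::metric_space set \<Rightarrow> ('a \<Rightarrow> complex) \<Rightarrow> ('a \<Rightarrow> complex) set" where
  "twist_orbit X f =
     {twist X \<alpha> \<epsilon> \<rho> f | \<alpha> \<epsilon> \<rho>. \<alpha> \<in> sphere 0 1 \<and> \<epsilon> \<in> {1, -1} \<and> surj_isometry X X \<rho>}"

lemma twist_in_Lip:
  fixes X :: "'a::metric_space set" and Y :: "'b::metric_space set"
  assumes "\<alpha> \<in> sphere 0 1" "surj_isometry Y X \<rho>" "f \<in> Lip X"
  shows "twist Y \<alpha> \<epsilon> \<rho> f \<in> Lip Y"
proof -
  obtain L where L: "0 \<le> L" "\<And>x y. x \<in> X \<Longrightarrow> y \<in> X \<Longrightarrow> cmod (f x - f y) \<le> L * dist x y"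
    using assms(3) by (metis LipE)
  show ?thesis
  proof (rule LipI[OF L(1)])
    fix x y assume xy: "x \<in> Y" "y \<in> Y"
    then have "twist Y \<alpha> \<epsilon> \<rho> f x - twist Y \<alpha> \<epsilon> \<rho> f y = \<alpha> * conj_exp (f (\<rho> x) - f (\<rho> y)) \<epsilon>"
      by (simp add: twist_def conj_exp_diff algebra_simps)
    then have "cmod (twist Y \<alpha> \<epsilon> \<rho> f x - twist Y \<alpha> \<epsilon> \<rho> f y) = cmod (f (\<rho> x) - f (\<rho> y))"
      using assms(1) by (simp add: norm_mult)
    also have "\<dots> \<le> L * dist x y"
      using L(2)[of "\<rho> x" "\<rho> y"] assms(2) xy by (auto simp: surj_isometry_def)
    finally show "cmod (twist Y \<alpha> \<epsilon> \<rho> f x - twist Y \<alpha> \<epsilon> \<rho> f y) \<le> L * dist x y" .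
  qed (simp add: twist_def)
qed

lemma twist_orbit_subset_Lip: "f \<in> Lip X \<Longrightarrow> twist_orbit X f \<subseteq> Lip X"
  by (auto simp: twist_orbit_def twist_in_Lip simp del: mem_sphere)

text \<open>Twists compose to twists. The outer conjugation also hits the inner scalar, which is why
  the composite has coefficient \<open>\<beta> * conj_exp \<alpha> \<delta>\<close>.\<close>

lemma twist_orbit_trans:
  assumes "g \<in> twist_orbit X f" "h \<in> twist_orbit X g"
  shows "h \<in> twist_orbit X f"
proof -
  obtain \<alpha> \<epsilon> \<rho> where g: "g = twist X \<alpha> \<epsilon> \<rho> f" "\<alpha> \<in> sphere 0 1" "\<epsilon> \<in> {1, -1}" "surj_isometry X X \<rho>"
    using assms(1) unfolding twist_orbit_def by blast
  obtain \<beta> \<delta> \<pi> where h: "h = twist X \<beta> \<delta> \<pi> g" "\<beta> \<in> sphere 0 1" "\<delta> \<in> {1, -1}" "surj_isometry X X \<pi>"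
    using assms(2) unfolding twist_orbit_def by blast
  have "\<pi> x \<in> X" if "x \<in> X" for x
    using h(4) that by (auto simp: surj_isometry_def)
  then have "h = twist X (\<beta> * conj_exp \<alpha> \<delta>) (\<epsilon> * \<delta>) (\<rho> \<circ> \<pi>) f"
    by (auto simp: h(1) g(1) twist_def fun_eq_iff conj_exp_mult
        conj_exp_conj_exp[OF g(3) h(3)])
  moreover have "\<beta> * conj_exp \<alpha> \<delta> \<in> sphere 0 1" "\<epsilon> * \<delta> \<in> {1, -1}"
    using g(2,3) h(2,3) by (auto simp: norm_mult)
  ultimately show ?thesis
    unfolding twist_orbit_def using surj_isometry_compose[OF h(4) g(4)] by blast
qed

lemma self_in_twist_orbit: "f \<in> Lip X \<Longrightarrow> f \<in> twist_orbit X f"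
  unfolding twist_orbit_def
  by (intro CollectI exI[of _ 1] exI[of _ "1::int"] exI[of _ id])
    (auto simp: twist_def conj_exp_def surj_isometry_def Lip_iff fun_eq_iff)

text \<open>Scalars, exponents and isometries cluster along common indices; the Lipschitz bound on
  \<open>f\<close> then turns uniform closeness of the isometries into uniform closeness of the
  twisted functions.\<close>

lemma twist_orbit_cluster:
  fixes X :: "'a::metric_space set"
  assumes "compact X" and f: "f \<in> Lip X" and s: "range (s :: nat \<Rightarrow> _) \<subseteq> twist_orbit X f"
  shows "\<exists>g\<in>twist_orbit X f. \<forall>e>0. \<forall>N. \<exists>n\<ge>N. \<forall>x\<in>X. cmod (s n x - g x) \<le> e"
proof -
  have "\<forall>n. \<exists>\<alpha> \<epsilon> \<rho>. s n = twist X \<alpha> \<epsilon> \<rho> f \<and> \<alpha> \<in> sphere 0 1 \<and> \<epsilon> \<in> {1, -1} \<and> surj_isometry X X \<rho>"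
    using s unfolding twist_orbit_def by blast
  then obtain \<alpha> \<epsilon> \<rho> where seq: "\<And>n. s n = twist X (\<alpha> n) (\<epsilon> n) (\<rho> n) f" "\<And>n. \<alpha> n \<in> sphere 0 1"
    "\<And>n. \<epsilon> n \<in> {1, -1}" "\<And>n. surj_isometry X X (\<rho> n)"
    by metis
  \<comment> \<open>The exponents are passed to the reals because \<^typ>\<open>int\<close> is not an instance of \<^class>\<open>metric_space\<close>.\<close>
  have coeff_compact: "compact (sphere 0 1 \<times> {1, -1} :: (complex \<times> real) set)"
    by (intro compact_Times compact_sphere finite_imp_compact) auto
  have coeff: "(\<alpha> n, real_of_int (\<epsilon> n)) \<in> sphere 0 1 \<times> {1, -1}" for n
    using seq(2)[of n] seq(3)[of n] by auto
  have \<rho>: "\<rho> n ` X \<subseteq> X" "\<And>x y. x \<in> X \<Longrightarrow> y \<in> X \<Longrightarrow> dist (\<rho> n x) (\<rho> n y) = dist x y" for n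
    using seq(4)[of n] by (auto simp: surj_isometry_def)
  obtain p \<sigma> where p: "p \<in> sphere 0 1 \<times> {1, -1 :: real}" and \<sigma>: "\<sigma> ` X \<subseteq> X"
    "\<And>x y. x \<in> X \<Longrightarrow> y \<in> X \<Longrightarrow> dist (\<sigma> x) (\<sigma> y) = dist x y"
    and near: "\<And>e N. e > 0 \<Longrightarrow>
      \<exists>n\<ge>N. dist (\<alpha> n, real_of_int (\<epsilon> n)) p < e \<and> (\<forall>x\<in>X. dist (\<rho> n x) (\<sigma> x) < e)"
    by (rule isometries_cluster[where c = "\<lambda>n. (\<alpha> n, real_of_int (\<epsilon> n))" and \<rho> = \<rho>,
          OF assms(1) assms(1) coeff_compact coeff \<rho>]) (assumption | rule that)+
  obtain a r where p_pair: "p = (a, r)" by fastforce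
  have a: "a \<in> sphere 0 1" and "r \<in> {1, -1}"
    using p by (auto simp: p_pair)
  then obtain \<delta> :: int where \<delta>: "\<delta> \<in> {1, -1}" and p_eq: "p = (a, real_of_int \<delta>)"
    by (cases "r = 1") (auto simp: p_pair)
  have "\<sigma> ` X = X"
    using compact_isometric_self_map_surj[OF \<open>compact X\<close>, of \<sigma>] \<sigma> by blast
  then have "surj_isometry X X \<sigma>"
    using \<sigma>(2) by (simp add: surj_isometry_def)
  then have orbit: "twist X a \<delta> \<sigma> f \<in> twist_orbit X f"
    unfolding twist_orbit_def using a \<delta> by blast
  obtain L where L: "0 \<le> L" "\<And>x y. x \<in> X \<Longrightarrow> y \<in> X \<Longrightarrow> cmod (f x - f y) \<le> L * dist x y"
    using f by (metis LipE)
  have "bounded (f ` X)"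
    using f \<open>compact X\<close> by (auto simp: Lip_def intro: compact_imp_bounded compact_continuous_image)
  then obtain M where M: "0 < M" "\<And>x. x \<in> X \<Longrightarrow> cmod (f x) \<le> M"
    by (auto simp: bounded_pos)
  have "\<exists>n\<ge>N. \<forall>x\<in>X. cmod (s n x - twist X a \<delta> \<sigma> f x) \<le> e" if "e > 0" for e N
  proof -
    \<comment> \<open>The final estimate is \<open>d * M + L * d\<close>, whence the quotient by
      \<open>M + L\<close>. The cap 1 forces \<open>\<epsilon> n = \<delta>\<close>, as distinct
      integers differ by at least 1.\<close>
    define d where "d = min 1 (e / (M + L))"
    have pos: "M + L > 0"
      using M(1) L(1) by simp
    have d: "d > 0" "d \<le> 1" and "d \<le> e / (M + L)"
      using \<open>e > 0\<close> pos by (auto simp: d_def)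
    then have d_le: "(M + L) * d \<le> e"
      using pos by (simp add: pos_le_divide_eq mult.commute)
    obtain n where n: "n \<ge> N" "dist (\<alpha> n, real_of_int (\<epsilon> n)) (a, real_of_int \<delta>) < d" "\<And>x. x \<in> X \<Longrightarrow> dist (\<rho> n x) (\<sigma> x) < d"
      using near[OF d(1), of N] by (auto simp: p_eq)
    have \<alpha>: "cmod (\<alpha> n - a) < d"
      using dist_fst_le[of "(\<alpha> n, real_of_int (\<epsilon> n))" "(a, real_of_int \<delta>)"] n(2) by (simp add: dist_norm)
    have "dist (real_of_int (\<epsilon> n)) (real_of_int \<delta>) < 1"
      using dist_snd_le[of "(\<alpha> n, real_of_int (\<epsilon> n))" "(a, real_of_int \<delta>)"] n(2) d(2) by simp
    then have \<epsilon>: "\<epsilon> n = \<delta>"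
      by (simp add: dist_norm)
    have "cmod (s n x - twist X a \<delta> \<sigma> f x) \<le> e" if x: "x \<in> X" for x
    proof -
      have in_X: "\<rho> n x \<in> X" "\<sigma> x \<in> X"
        using seq(4)[of n] \<sigma>(1) x by (auto simp: surj_isometry_def)
      have "s n x - twist X a \<delta> \<sigma> f x =
          (\<alpha> n - a) * conj_exp (f (\<rho> n x)) \<delta> + a * conj_exp (f (\<rho> n x) - f (\<sigma> x)) \<delta>"
        using x by (simp add: seq(1) twist_def \<epsilon> conj_exp_diff algebra_simps)
      also have "cmod \<dots> \<le> cmod (\<alpha> n - a) * cmod (f (\<rho> n x)) + cmod (f (\<rho> n x) - f (\<sigma> x))"
        using a by (intro norm_triangle_le) (simp add: norm_mult)
      also have "\<dots> \<le> d * M + L * d"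
      proof (intro add_mono mult_mono)
        have "cmod (f (\<rho> n x) - f (\<sigma> x)) \<le> L * dist (\<rho> n x) (\<sigma> x)"
          using L(2) in_X by blast
        also have "\<dots> \<le> L * d"
          using n(3)[OF x] L(1) by (intro mult_left_mono) auto
        finally show "cmod (f (\<rho> n x) - f (\<sigma> x)) \<le> L * d" .
      qed (use \<alpha> M in_X d in auto)
      also have "\<dots> \<le> e"
        using d_le by (simp add: algebra_simps)
      finally show ?thesis .
    qed
    with n(1) show ?thesis by blast
  qed
  with orbit show ?thesis by blast
qed

section \<open>Surjectivity of self-maps acting by twists\<close>

text \<open>By \<open>orbit\<close> and transitivity, \<open>U\<close> maps the orbit of
  \<open>f\<close> into itself; by \<open>diff\<close> it preserves uniform distances there. So it
  is onto that orbit, to which \<open>f\<close> itself belongs.\<close>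

lemma two_local_self_map_surj:
  fixes X :: "'a::metric_space set"
  assumes "compact X" and f: "f \<in> Lip X"
    and orbit: "\<And>g. g \<in> Lip X \<Longrightarrow> U g \<in> twist_orbit X g"
    and diff: "\<And>g h. g \<in> Lip X \<Longrightarrow> h \<in> Lip X \<Longrightarrow>
      (\<lambda>x. U g x - U h x) \<in> twist_orbit X (\<lambda>x. g x - h x)"
  shows "f \<in> U ` Lip X"
proof -
  have sub: "twist_orbit X f \<subseteq> Lip X"
    using f by (rule twist_orbit_subset_Lip)
  have "U ` twist_orbit X f = twist_orbit X f"
  proof (rule isometric_self_map_surj[where E = "\<lambda>e g h. \<forall>x\<in>X. cmod (g x - h x) \<le> e"])
    fix d e and g h k :: "'a \<Rightarrow> complex"
    assume "\<forall>x\<in>X. cmod (g x - h x) \<le> d" "\<forall>x\<in>X. cmod (h x - k x) \<le> e"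
    then show "\<forall>x\<in>X. cmod (g x - k x) \<le> d + e"
      by (meson add_mono norm_diff_triangle_le)
  next
    fix g h assume gh: "g \<in> twist_orbit X f" "h \<in> twist_orbit X f"
      and small: "\<And>e. e > 0 \<Longrightarrow> \<forall>x\<in>X. cmod (g x - h x) \<le> e"
    have "cmod (g x - h x) \<le> 0" if "x \<in> X" for x
      by (rule field_le_epsilon) (use small that in simp)
    then show "g = h"
      using gh sub by (intro Lip_eqI[of g X h]) auto
  next
    fix s :: "nat \<Rightarrow> 'a \<Rightarrow> complex" assume "range s \<subseteq> twist_orbit X f"
    then show "\<exists>a\<in>twist_orbit X f. \<forall>e>0. \<forall>N. \<exists>n\<ge>N. \<forall>x\<in>X. cmod (s n x - a x) \<le> e"
      by (rule twist_orbit_cluster[OF \<open>compact X\<close> f])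
  next
    show "U \<in> twist_orbit X f \<rightarrow> twist_orbit X f"
      using orbit sub twist_orbit_trans by blast
  next
    fix e and g h :: "'a \<Rightarrow> complex"
    assume gh: "g \<in> twist_orbit X f" "h \<in> twist_orbit X f"
    then obtain \<alpha> \<epsilon> \<rho> where \<alpha>: "\<alpha> \<in> sphere 0 1" and \<rho>: "surj_isometry X X \<rho>"
      and eq: "(\<lambda>x. U g x - U h x) = twist X \<alpha> \<epsilon> \<rho> (\<lambda>x. g x - h x)"
      using diff[of g h] sub unfolding twist_orbit_def by blast
    \<comment> \<open>Unimodular scalars and conjugation leave moduli unchanged, and
      \<open>\<rho>\<close> maps \<open>X\<close> onto \<open>X\<close>, so the bounds over
      \<open>X\<close> for both differences are equivalent.\<close>
    have "cmod (U g x - U h x) = cmod (g (\<rho> x) - h (\<rho> x))" if "x \<in> X" for x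
      using fun_cong[OF eq, of x] \<alpha> that by (simp add: twist_def norm_mult)
    then have "(\<forall>x\<in>X. cmod (U g x - U h x) \<le> e) \<longleftrightarrow> (\<forall>x\<in>X. cmod (g (\<rho> x) - h (\<rho> x)) \<le> e)"
      by simp
    also have "\<dots> \<longleftrightarrow> (\<forall>x\<in>\<rho> ` X. cmod (g x - h x) \<le> e)"
      by simp
    also have "\<rho> ` X = X"
      using \<rho> by (simp add: surj_isometry_def)
    finally show "(\<forall>x\<in>X. cmod (U g x - U h x) \<le> e) \<longleftrightarrow> (\<forall>x\<in>X. cmod (g x - h x) \<le> e)" .
  qed (auto simp: norm_minus_commute intro: order_trans)
  then have "f \<in> U ` twist_orbit X f"
    using self_in_twist_orbit[OF f] by simp
  with sub show ?thesis by blast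
qed

section \<open>Reduction to a self-map of \<open>Lip X1\<close>\<close>

theorem corollary13:
  fixes X1 :: "'a::metric_space set" and X2 :: "'b::metric_space set"
    and N1 :: "('a \<Rightarrow> complex) \<Rightarrow> real" and N2 :: "('b \<Rightarrow> complex) \<Rightarrow> real"
    and T :: "('a \<Rightarrow> complex) \<Rightarrow> ('b \<Rightarrow> complex)"
  assumes "compact X1" and "compact X2"
    and "norm_on (Lip X1) N1" and "norm_on (Lip X2) N2"
    and "Iso (Lip X1) N1 (Lip X2) N2 = canonical_maps X1 X2"
    and "two_local_in_Iso (Lip X1) N1 (Lip X2) N2 T"
  shows "T \<in> Iso (Lip X1) N1 (Lip X2) N2"
proof -
  have T: "T f \<in> Lip X2" if "f \<in> Lip X1" for f
    using assms(6) that unfolding two_local_in_Iso_def by blast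
  have local: "\<exists>S\<in>Iso (Lip X1) N1 (Lip X2) N2. T f = S f \<and> T g = S g"
    if "f \<in> Lip X1" "g \<in> Lip X1" for f g
    using assms(6) that unfolding two_local_in_Iso_def by blast
  \<comment> \<open>A single \<open>S\<close> agrees with \<open>T\<close> at both \<open>f\<close>
    and \<open>g\<close>, so its translation \<open>\<beta>\<close> cancels in the
    difference.\<close>
  have T_diff: "\<exists>\<alpha> \<epsilon> \<pi>. \<alpha> \<in> sphere 0 1 \<and> \<epsilon> \<in> {1, -1} \<and> surj_isometry X2 X1 \<pi> \<and>
      (\<forall>y\<in>X2. T f y - T g y = \<alpha> * conj_exp (f (\<pi> y) - g (\<pi> y)) \<epsilon>)"
    if fg: "f \<in> Lip X1" "g \<in> Lip X1" for f g
  proof -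
    obtain S where S: "S \<in> canonical_maps X1 X2" "T f = S f" "T g = S g"
      using local[OF fg] assms(5) by blast
    then obtain \<beta> \<alpha> \<pi> \<epsilon> where "\<alpha> \<in> sphere 0 1" "\<epsilon> \<in> {1, -1}" "surj_isometry X2 X1 \<pi>"
      "\<forall>f\<in>Lip X1. \<forall>y\<in>X2. S f y = \<beta> y + \<alpha> * conj_exp (f (\<pi> y)) \<epsilon>"
      unfolding canonical_maps_def by blast
    with fg S(2,3) show ?thesis
      by (intro exI[of _ \<alpha>] exI[of _ \<epsilon>] exI[of _ \<pi>]) (simp add: conj_exp_diff algebra_simps)
  qed
  \<comment> \<open>Two-locality at any pair provides an isometry between the spaces; the zero
    function is a member of \<open>Lip X1\<close> always at hand.\<close>
  obtain \<pi>0 where \<pi>0: "surj_isometry X2 X1 \<pi>0"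
    using T_diff[OF zero_in_Lip zero_in_Lip] by blast
  obtain \<sigma> where \<sigma>: "surj_isometry X1 X2 \<sigma>" "\<And>y. y \<in> X2 \<Longrightarrow> \<sigma> (\<pi>0 y) = y"
    using surj_isometry_inverse[OF \<pi>0] by blast
  have \<sigma>_in: "\<sigma> x \<in> X2" if "x \<in> X1" for x
    using \<sigma>(1) that by (auto simp: surj_isometry_def)
  \<comment> \<open>Normalised to fix 0 and pulled back along \<open>\<sigma>\<close>, so that
    \<open>U\<close> acts on functions on \<open>X1\<close> alone.\<close>
  define U where "U f = twist X1 1 1 \<sigma> (\<lambda>y. T f y - T (\<lambda>_. 0) y)" for f
  have U_diff: "(\<lambda>x. U f x - U g x) \<in> twist_orbit X1 (\<lambda>x. f x - g x)"
    if "f \<in> Lip X1" "g \<in> Lip X1" for f g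
  proof -
    obtain \<alpha> \<epsilon> \<pi> where S: "\<alpha> \<in> sphere 0 1" "\<epsilon> \<in> {1, -1}" "surj_isometry X2 X1 \<pi>"
      "\<forall>y\<in>X2. T f y - T g y = \<alpha> * conj_exp (f (\<pi> y) - g (\<pi> y)) \<epsilon>"
      using T_diff[OF \<open>f \<in> Lip X1\<close> \<open>g \<in> Lip X1\<close>] by blast
    have "(\<lambda>x. U f x - U g x) = twist X1 \<alpha> \<epsilon> (\<pi> \<circ> \<sigma>) (\<lambda>x. f x - g x)"
      using S(4) \<sigma>_in by (auto simp: U_def twist_def conj_exp_def fun_eq_iff)
    with S show ?thesis
      unfolding twist_orbit_def using surj_isometry_compose[OF \<sigma>(1) S(3)] by blast
  qed
  \<comment> \<open>With 0 fixed, the orbit condition is the special case \<open>g = 0\<close> of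
    \<open>U_diff\<close>.\<close>
  have "U (\<lambda>_. 0) = (\<lambda>_. 0)"
    by (simp add: U_def twist_def conj_exp_def fun_eq_iff)
  then have U_orbit: "U f \<in> twist_orbit X1 f" if "f \<in> Lip X1" for f
    using U_diff[OF that zero_in_Lip] by simp
  have "h \<in> T ` Lip X1" if h: "h \<in> Lip X2" for h
  proof -
    have h0: "(\<lambda>y. h y - T (\<lambda>_. 0) y) \<in> Lip X2"
      using h T zero_in_Lip by (intro Lip_diff) auto
    \<comment> \<open>A preimage of \<open>h\<close> under \<open>T\<close> is a preimage under
      \<open>U\<close> of the normalised and transported \<open>h\<close>; evaluating at
      \<open>\<pi>0 y\<close> undoes the transport, and the \<open>T 0\<close> terms cancel.\<close>
    have "twist X1 1 1 \<sigma> (\<lambda>y. h y - T (\<lambda>_. 0) y) \<in> U ` Lip X1"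
      using \<sigma>(1) h0 U_orbit U_diff
      by (intro two_local_self_map_surj[OF assms(1)] twist_in_Lip) auto
    then obtain f where f: "f \<in> Lip X1" "twist X1 1 1 \<sigma> (\<lambda>y. h y - T (\<lambda>_. 0) y) = U f"
      by blast
    have "h y = T f y" if y: "y \<in> X2" for y
    proof -
      have "\<pi>0 y \<in> X1"
        using \<pi>0 y by (auto simp: surj_isometry_def)
      then show ?thesis
        using fun_cong[OF f(2), of "\<pi>0 y"] \<sigma>(2)[OF y] by (simp add: U_def twist_def conj_exp_def)
    qed
    then have "h = T f"
      using h T f(1) by (intro Lip_eqI[of h X2]) auto
    with f(1) show ?thesis by blast
  qed
  with T have "T ` Lip X1 = Lip X2"
    by blast
  moreover have "N2 (\<lambda>y. T f y - T g y) = N1 (\<lambda>x. f x - g x)"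
    if fg: "f \<in> Lip X1" "g \<in> Lip X1" for f g
    using local[OF fg] fg unfolding Iso_def by auto
  ultimately show ?thesis
    by (simp add: Iso_def)
qed

end
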